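(* Let $D$ be a connected simple digraph. The Smith group of $D$ has exactly one invariant factor equal to $1$ if and only if $D$ is isomorphic to a digraph $\Lambda_{n_1,n_2,n_3}$, where the integers $n_1,n_2,n_3$ satisfy one of the following conditions: (1) $n_1=n_2=1$, $n_3=0$; (2) $n_1=n_3=1$, $n_2=0$; (3) $n_2=n_3=1$, $n_1=0$; (4) $n_1\geq2$, $n_2=1$, $n_3=0$; (5) $n_1=0$, $n_2=1$, $n_3\geq2$; (6) $n_1=1$, $n_2=0$, $n_3\geq2$; (7) $n_1\geq2$, $n_2=0$, $n_3=1$; (8) $n_1\geq2$, $n_2=0$, $n_3\geq2$.
   Context: Digraphs are finite and have no loops. A digraph is connected if its underlying undirected graph is connected. A digraph is simple if for each ordered pair $(u,v)$ of distinct vertices there is at most one arc from $u$ to $v$ (both arcs $u\to v$ and $v\to u$ may be present). The adjacency matrix $A(D)$ of a digraph $D$ has rows and columns indexed by the vertices, with $A(D)_{uv}=m_{uv}$, the number of arcs from $u$ to $v$ (so the diagonal is zero). The Smith group $S(D)$ is the cokernel of $A(D)$. Its invariant factors are those of $A(D)$, i.e. the diagonal entries of the Smith normal form of $A(D)$ over $\mathbb{Z}$ (so $f_i=\Delta_i(A(D))/\Delta_{i-1}(A(D))$ when $\Delta_{i-1}(A(D))\neq0$, where $\Delta_i$ is the greatest common divisor of the $i$-minors and $\Delta_0=1$). "Exactly one invariant factor equal to $1$" means that exactly one of these diagonal entries equals $1$. For integers $n_1,n_2,n_3\geq0$, $\Lambda_{n_1,n_2,n_3}$ is the simple digraph whose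 vertex set is partitioned into three sets $T,K,T'$ of sizes $n_1,n_2,n_3$ respectively, and whose arcs are exactly: both arcs between every pair of distinct vertices of $K$; every arc from a vertex of $T$ to a vertex of $K$; every arc from a vertex of $T$ to a vertex of $T'$; and every arc from a vertex of $K$ to a vertex of $T'$. (There are no arcs inside $T$ or inside $T'$.) *)

theory Defs
  imports
    "Graph_Theory.Graph_Theory"
    "Jordan_Normal_Form.Matrix"
begin

text \<open>
  Matrices in \<open>Jordan_Normal_Form\<close> are indexed by natural numbers, so the adjacency matrix is
  taken with respect to an enumeration \<open>vs\<close> of the vertices. Another enumeration conjugates
  it by a permutation matrix, which does not affect its Smith normal form.
\<close>

definition adjacency_mat :: "('a, 'b) pre_digraph \<Rightarrow> 'a list \<Rightarrow> int mat" where
  "adjacency_mat D vs = mat (length vs) (length vs)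
     (\<lambda>(i, j). int (card {e \<in> arcs D. tail D e = vs ! i \<and> head D e = vs ! j}))"

text \<open>
  Divisibility forces the zero entries of a Smith normal form to the end of the diagonal,
  since \<open>0 dvd x\<close> only for \<open>x = 0\<close>. \<open>invertible_mat\<close> is over the integers, so \<open>P\<close> and \<open>Q\<close>
  below are unimodular.
\<close>

definition is_smith_normal_form :: "int mat \<Rightarrow> int mat \<Rightarrow> bool" where
  "is_smith_normal_form A S \<longleftrightarrow>
     S \<in> carrier_mat (dim_row A) (dim_col A) \<and>
     diagonal_mat S \<and>
     (\<forall>i < min (dim_row S) (dim_col S). 0 \<le> S $$ (i, i)) \<and>
     (\<forall>i. Suc i < min (dim_row S) (dim_col S) \<longrightarrow> S $$ (i, i) dvd S $$ (Suc i, Suc i)) \<and>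
     (\<exists>P Q. P \<in> carrier_mat (dim_row A) (dim_row A) \<and> invertible_mat P \<and>
            Q \<in> carrier_mat (dim_col A) (dim_col A) \<and> invertible_mat Q \<and>
            S = P * A * Q)"

text \<open>
  Every integer matrix has exactly one Smith normal form with nonnegative diagonal entries.
\<close>

definition smith_normal_form :: "int mat \<Rightarrow> int mat" where
  "smith_normal_form A = (THE S. is_smith_normal_form A S)"

text \<open>
  The invariant factors include the ones equal to \<open>1\<close>, which are invisible in the isomorphism
  type of the cokernel, and the zeros, which give its free part. The invariant factors of the
  Smith group of \<open>D\<close> are by definition those of its adjacency matrix.
\<close>

definition invariant_factors :: "int mat \<Rightarrow> int list" where
  "invariant_factors A =
     map (\<lambda>i. smith_normal_form A $$ (i, i)) [0..<min (dim_row A) (dim_col A)]"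

datatype lambda_vertex = VT nat | VK nat | VT' nat

definition Lambda_digraph ::
    "nat \<Rightarrow> nat \<Rightarrow> nat \<Rightarrow> (lambda_vertex, lambda_vertex \<times> lambda_vertex) pre_digraph" where
  "Lambda_digraph n1 n2 n3 =
     (let T = VT ` {..<n1}; K = VK ` {..<n2}; T' = VT' ` {..<n3}
      in with_proj \<lparr> pverts = T \<union> K \<union> T',
           parcs = {(u, v). u \<in> K \<and> v \<in> K \<and> u \<noteq> v} \<union> T \<times> K \<union> T \<times> T' \<union> K \<times> T' \<rparr>)"

end

theory Submission
  imports Defs "Jordan_Normal_Form.Column_Operations" "Jordan_Normal_Form.Determinant"
begin

text \<open>
  A $2$-minor of a matrix with entries $0$ and $1$ is a difference of two numbers from
  \<open>{0, 1}\<close>, hence $-1$, $0$ or $1$. If exactly one invariant factor of such a matrix is $1$, it is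
  the first one, and the second one, $s$, is either absent or different from $1$. Modulo $s$ the
  matrix is a product of a column and a row, so $s$ divides all $2$-minors; being small they
  vanish, and the matrix is the indicator of a rectangle \<open>X \<times> Y\<close> with nonempty sides
  (\<open>zero_one_mat_one_unit_invariant_factor_iff\<close>). Conversely, the indicator of such a rectangle
  has rank one and an entry $1$, so its invariant factors are $1, 0, \dots, 0$.

  For the adjacency matrix this says that the arcs form a product \<open>X \<times> Y\<close>. The absence of loops
  makes \<open>X\<close> and \<open>Y\<close> disjoint, and by connectedness every vertex is incident to an arc, so
  \<open>X \<union> Y\<close> is the vertex set: the digraph is a complete bipartite graph with all arcs directed from
  \<open>X\<close> to \<open>Y\<close>, that is, \<open>\<Lambda>\<close> with parameters \<open>card X\<close>, \<open>0\<close>, \<open>card Y\<close>. In the listed cases with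
  \<open>n2 = 1\<close> one outer part is empty, so the single vertex of \<open>K\<close> plays the role of a one-element
  \<open>T\<close> or \<open>T'\<close>, and all eight cases are of this bipartite form.

  Since invariant factors are read off a Smith normal form chosen by a definite description,
  its existence and its uniqueness are needed. Existence is the usual reduction to a least
  positive entry (\<open>mat_equivalent_split_corner\<close>). For uniqueness, two equivalent diagonal forms are
  compared entry by entry: evaluating the matrix identity at one suitably scaled integer vector
  shows that each diagonal entry divides the other (\<open>diagonal_entry_dvd\<close>).
\<close>

section \<open>Unimodular equivalence of matrices\<close>

lemma invertible_matI:
  assumes "P \<in> carrier_mat n n" "P' \<in> carrier_mat n n" "P * P' = 1\<^sub>m n" "P' * P = 1\<^sub>m n"
  shows "invertible_mat P"
  using assms unfolding invertible_mat_def inverts_mat_def by auto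

lemma invertible_matE:
  assumes "invertible_mat P" "P \<in> carrier_mat n n"
  obtains P' where "P' \<in> carrier_mat n n" "P * P' = 1\<^sub>m n" "P' * P = 1\<^sub>m n"
proof -
  from assms obtain P' where P': "P * P' = 1\<^sub>m n" "P' * P = 1\<^sub>m (dim_row P')"
    unfolding invertible_mat_def inverts_mat_def by auto
  have "dim_col P' = n" using arg_cong[OF P'(1), of dim_col] by simp
  moreover have "dim_row P' = n" using arg_cong[OF P'(2), of dim_col] assms(2) by simp
  ultimately show ?thesis using P' by (intro that[of P']) auto
qed

lemma invertible_mat_one: "invertible_mat (1\<^sub>m n)"
  by (rule invertible_matI[of _ n "1\<^sub>m n"]) auto

lemma invertible_mat_mult:
  assumes "invertible_mat P" "P \<in> carrier_mat n n" "invertible_mat Q" "Q \<in> carrier_mat n n"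
  shows "invertible_mat (P * Q)"
proof -
  obtain P' where P': "P' \<in> carrier_mat n n" "P * P' = 1\<^sub>m n" "P' * P = 1\<^sub>m n"
    using invertible_matE[OF assms(1,2)] .
  obtain Q' where Q': "Q' \<in> carrier_mat n n" "Q * Q' = 1\<^sub>m n" "Q' * Q = 1\<^sub>m n"
    using invertible_matE[OF assms(3,4)] .
  note c = assms(2,4) P'(1) Q'(1)
  have "P * Q * (Q' * P') = P * (Q * Q') * P'"
    using c by (simp add: assoc_mult_mat[where ?n\<^sub>1=n and ?n\<^sub>2=n and ?n\<^sub>3=n and ?n\<^sub>4=n])
  moreover have "Q' * P' * (P * Q) = Q' * (P' * P) * Q"
    using c by (simp add: assoc_mult_mat[where ?n\<^sub>1=n and ?n\<^sub>2=n and ?n\<^sub>3=n and ?n\<^sub>4=n])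
  ultimately show ?thesis
    using c P' Q' by (intro invertible_matI[of _ n "Q' * P'"]) auto
qed

text \<open>
  This is the last conjunct of \<open>is_smith_normal_form\<close>, isolated because it is an equivalence
  relation that contains the elementary row and column operations.
\<close>

definition mat_equivalent :: "'a :: comm_ring_1 mat \<Rightarrow> 'a mat \<Rightarrow> bool" where
  "mat_equivalent A B \<longleftrightarrow>
     (\<exists>P Q. P \<in> carrier_mat (dim_row A) (dim_row A) \<and> invertible_mat P \<and>
            Q \<in> carrier_mat (dim_col A) (dim_col A) \<and> invertible_mat Q \<and> B = P * A * Q)"

lemma mat_equivalentI:
  assumes "A \<in> carrier_mat nr nc" "P \<in> carrier_mat nr nr" "invertible_mat P"
    "Q \<in> carrier_mat nc nc" "invertible_mat Q" "B = P * A * Q"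
  shows "mat_equivalent A B"
  unfolding mat_equivalent_def using assms by (intro exI[of _ P] exI[of _ Q]) simp

lemma mat_equivalentE:
  assumes "mat_equivalent A B" "A \<in> carrier_mat nr nc"
  obtains P Q where "P \<in> carrier_mat nr nr" "invertible_mat P"
    "Q \<in> carrier_mat nc nc" "invertible_mat Q" "B = P * A * Q" "B \<in> carrier_mat nr nc"
  using assms unfolding mat_equivalent_def by auto

lemma mat_equivalent_carrier:
  "mat_equivalent A B \<Longrightarrow> A \<in> carrier_mat nr nc \<Longrightarrow> B \<in> carrier_mat nr nc"
  by (elim mat_equivalentE)

lemma mat_equivalent_refl: "mat_equivalent A A"
  unfolding mat_equivalent_def
  by (intro exI[of _ "1\<^sub>m (dim_row A)"] exI[of _ "1\<^sub>m (dim_col A)"]) (auto simp: invertible_mat_one)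

lemma mat_equivalent_trans:
  assumes "mat_equivalent A B" "mat_equivalent B C"
  shows "mat_equivalent A C"
proof -
  define nr nc where "nr = dim_row A" and "nc = dim_col A"
  have A: "A \<in> carrier_mat nr nc" by (simp add: nr_def nc_def)
  obtain P Q where 1: "P \<in> carrier_mat nr nr" "invertible_mat P"
    "Q \<in> carrier_mat nc nc" "invertible_mat Q" "B = P * A * Q" "B \<in> carrier_mat nr nc"
    using mat_equivalentE[OF assms(1) A] .
  obtain P' Q' where 2: "P' \<in> carrier_mat nr nr" "invertible_mat P'"
    "Q' \<in> carrier_mat nc nc" "invertible_mat Q'" "C = P' * B * Q'"
    using mat_equivalentE[OF assms(2) 1(6)] .
  have PA: "P * A \<in> carrier_mat nr nc" using 1 A by simp
  have "C = P' * (P * A * Q * Q')"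
    using 1 2 PA by (simp add: assoc_mult_mat[where ?n\<^sub>1=nr and ?n\<^sub>2=nr and ?n\<^sub>3=nc and ?n\<^sub>4=nc])
  also have "P * A * Q * Q' = P * A * (Q * Q')"
    by (rule assoc_mult_mat[OF PA 1(3) 2(3)])
  also have "P' * \<dots> = (P' * (P * A)) * (Q * Q')"
    by (rule assoc_mult_mat[symmetric, OF 2(1) PA mult_carrier_mat[OF 1(3) 2(3)]])
  also have "P' * (P * A) = (P' * P) * A"
    by (rule assoc_mult_mat[symmetric, OF 2(1) 1(1) A])
  finally show ?thesis
    by (rule mat_equivalentI[OF A mult_carrier_mat[OF 2(1) 1(1)]
          invertible_mat_mult[OF 2(2,1) 1(2,1)] mult_carrier_mat[OF 1(3) 2(3)]
          invertible_mat_mult[OF 1(4,3) 2(4,3)]])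
qed

lemma mat_equivalent_sym:
  assumes "mat_equivalent A B"
  shows "mat_equivalent B A"
proof -
  define nr nc where "nr = dim_row A" and "nc = dim_col A"
  have A: "A \<in> carrier_mat nr nc" by (simp add: nr_def nc_def)
  obtain P Q where 1: "P \<in> carrier_mat nr nr" "invertible_mat P"
    "Q \<in> carrier_mat nc nc" "invertible_mat Q" "B = P * A * Q" "B \<in> carrier_mat nr nc"
    using mat_equivalentE[OF assms(1) A] .
  obtain P' where P': "P' \<in> carrier_mat nr nr" "P * P' = 1\<^sub>m nr" "P' * P = 1\<^sub>m nr"
    using invertible_matE[OF 1(2,1)] .
  obtain Q' where Q': "Q' \<in> carrier_mat nc nc" "Q * Q' = 1\<^sub>m nc" "Q' * Q = 1\<^sub>m nc"
    using invertible_matE[OF 1(4,3)] .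
  have "P' * B * Q' = P' * (B * Q')"
    by (rule assoc_mult_mat[OF P'(1) 1(6) Q'(1)])
  also have "B * Q' = (P * A) * (Q * Q')"
    unfolding 1(5) by (rule assoc_mult_mat) (use 1 A Q' in auto)
  also have "\<dots> = P * A" using Q' 1 A by auto
  also have "P' * (P * A) = P' * P * A"
    by (rule assoc_mult_mat[symmetric, OF P'(1) 1(1) A])
  also have "\<dots> = A" using P' A by simp
  finally show ?thesis
    by (intro mat_equivalentI[OF 1(6) P'(1) _ Q'(1)])
      (use P' Q' 1 in \<open>auto intro!: invertible_matI[of P' nr P] invertible_matI[of Q' nc Q]\<close>)
qed

lemma mat_equivalent_mult_left:
  assumes "A \<in> carrier_mat nr nc" "P \<in> carrier_mat nr nr" "invertible_mat P"
  shows "mat_equivalent A (P * A)"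
  by (rule mat_equivalentI[OF assms one_carrier_mat invertible_mat_one]) (use assms in auto)

lemma mat_equivalent_mult_right:
  assumes "A \<in> carrier_mat nr nc" "Q \<in> carrier_mat nc nc" "invertible_mat Q"
  shows "mat_equivalent A (A * Q)"
  by (rule mat_equivalentI[OF assms(1) one_carrier_mat invertible_mat_one assms(2,3)]) (use assms in auto)

lemma invertible_swaprows_mat:
  assumes "k < n" "l < n" shows "invertible_mat (swaprows_mat n k l)"
  using assms by (intro invertible_matI[of _ n "swaprows_mat n k l"]) (auto simp: swaprows_mat_inv)

lemma invertible_addrow_mat:
  assumes "k < n" "l < n" "k \<noteq> l"
  shows "invertible_mat (addrow_mat n (a :: 'a :: comm_ring_1) k l)"
  using addrow_mat_inv[OF assms, of a] addrow_mat_inv[OF assms, of "-a"]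
  by (intro invertible_matI[of _ n "addrow_mat n (-a) k l"]) auto

lemma mat_equivalent_swaprows:
  "A \<in> carrier_mat nr nc \<Longrightarrow> k < nr \<Longrightarrow> l < nr \<Longrightarrow> mat_equivalent A (swaprows k l A)"
  by (simp add: swaprows_mat mat_equivalent_mult_left invertible_swaprows_mat)

lemma mat_equivalent_swapcols:
  "A \<in> carrier_mat nr nc \<Longrightarrow> k < nc \<Longrightarrow> l < nc \<Longrightarrow> mat_equivalent A (swapcols k l A)"
  by (simp add: swapcols_mat mat_equivalent_mult_right invertible_swaprows_mat)

lemma mat_equivalent_addrow:
  "A \<in> carrier_mat nr nc \<Longrightarrow> k < nr \<Longrightarrow> l < nr \<Longrightarrow> k \<noteq> l \<Longrightarrow> mat_equivalent A (addrow a k l A)"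
  by (simp add: addrow_mat mat_equivalent_mult_left invertible_addrow_mat)

lemma mat_equivalent_addcol:
  "A \<in> carrier_mat nr nc \<Longrightarrow> k < nc \<Longrightarrow> l < nc \<Longrightarrow> k \<noteq> l \<Longrightarrow> mat_equivalent A (addcol a k l A)"
  by (simp add: addcol_mat[of _ nr nc] mat_equivalent_mult_right invertible_addrow_mat)

lemma mat_equivalent_uminus:
  fixes A :: "'a :: comm_ring_1 mat"
  shows "mat_equivalent A (- A)"
proof (rule mat_equivalentI[OF carrier_matI[OF refl refl] _ _ one_carrier_mat invertible_mat_one])
  let ?n = "dim_row A"
  show "- 1\<^sub>m ?n \<in> carrier_mat ?n ?n" by simp
  show "invertible_mat (- 1\<^sub>m ?n :: 'a mat)"
  proof -
    have "- 1\<^sub>m ?n * - 1\<^sub>m ?n = (1\<^sub>m ?n :: 'a mat)"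
      by (subst uminus_mult_left_mat) (simp, subst uminus_mult_right_mat, auto)
    from invertible_matI[OF _ _ this this] show ?thesis by simp
  qed
  show "- A = - 1\<^sub>m ?n * A * 1\<^sub>m (dim_col A)" by (simp add: uminus_mult_left_mat)
qed

lemma mat_equivalent_block_diag:
  assumes "mat_equivalent C D" "C \<in> carrier_mat m n" "b \<in> carrier_mat 1 1"
  shows "mat_equivalent (four_block_mat b (0\<^sub>m 1 n) (0\<^sub>m m 1) C)
           (four_block_mat b (0\<^sub>m 1 n) (0\<^sub>m m 1) D)"
proof -
  have inv: "invertible_mat (four_block_mat (1\<^sub>m 1) (0\<^sub>m 1 k) (0\<^sub>m k 1) P)"
    if P: "invertible_mat P" "P \<in> carrier_mat k k" for P :: "'a mat" and k
  proof -
    obtain P' where P': "P' \<in> carrier_mat k k" "P * P' = 1\<^sub>m k" "P' * P = 1\<^sub>m k"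
      using invertible_matE[OF P] .
    show ?thesis
      by (rule invertible_matI[of _ "1 + k" "four_block_mat (1\<^sub>m 1) (0\<^sub>m 1 k) (0\<^sub>m k 1) P'"])
        (use P P' in \<open>auto simp: mult_four_block_mat[of _ 1 1 _ k _ k _ _ 1 _ k]\<close>)
  qed
  obtain P Q where 1: "P \<in> carrier_mat m m" "invertible_mat P"
    "Q \<in> carrier_mat n n" "invertible_mat Q" "D = P * C * Q" "D \<in> carrier_mat m n"
    using mat_equivalentE[OF assms(1,2)] .
  show ?thesis
  proof (rule mat_equivalentI[OF _ _ inv[OF 1(2,1)] _ inv[OF 1(4,3)]])
    show "four_block_mat b (0\<^sub>m 1 n) (0\<^sub>m m 1) C \<in> carrier_mat (1 + m) (1 + n)"
      by (rule four_block_carrier_mat[OF assms(3,2)])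
    have "four_block_mat (1\<^sub>m 1) (0\<^sub>m 1 m) (0\<^sub>m m 1) P * four_block_mat b (0\<^sub>m 1 n) (0\<^sub>m m 1) C
        = four_block_mat b (0\<^sub>m 1 n) (0\<^sub>m m 1) (P * C)"
      by (subst mult_four_block_mat[of _ 1 1 _ m _ m _ _ 1 _ n])
        (use assms 1 in \<open>auto simp del: One_nat_def intro!: cong_four_block_mat\<close>)
    also have "\<dots> * four_block_mat (1\<^sub>m 1) (0\<^sub>m 1 n) (0\<^sub>m n 1) Q
        = four_block_mat b (0\<^sub>m 1 n) (0\<^sub>m m 1) (P * C * Q)"
      by (subst mult_four_block_mat[of _ 1 1 _ n _ m _ _ 1 _ n])
        (use assms 1 in \<open>auto simp del: One_nat_def intro!: cong_four_block_mat\<close>)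
    finally show "four_block_mat b (0\<^sub>m 1 n) (0\<^sub>m m 1) D =
      four_block_mat (1\<^sub>m 1) (0\<^sub>m 1 m) (0\<^sub>m m 1) P * four_block_mat b (0\<^sub>m 1 n) (0\<^sub>m m 1) C *
      four_block_mat (1\<^sub>m 1) (0\<^sub>m 1 n) (0\<^sub>m n 1) Q"
      by (simp only: 1(5))
  qed (rule four_block_carrier_mat[OF one_carrier_mat 1(1)]
      four_block_carrier_mat[OF one_carrier_mat 1(3)])+
qed

section \<open>Existence of the Smith normal form\<close>

lemma invertible_lower_unitriangular:
  fixes L :: "'a :: comm_ring_1 mat"
  assumes "L \<in> carrier_mat m n"
  shows "invertible_mat (four_block_mat (1\<^sub>m n) (0\<^sub>m n m) L (1\<^sub>m m))"
proof -
  have inverse: "four_block_mat (1\<^sub>m n) (0\<^sub>m n m) X (1\<^sub>m m) * four_block_mat (1\<^sub>m n) (0\<^sub>m n m) (- X) (1\<^sub>m m)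
      = 1\<^sub>m (n + m)" if X: "X \<in> carrier_mat m n" for X :: "'a mat"
  proof -
    have "1\<^sub>m n * 1\<^sub>m n + 0\<^sub>m n m * - X = 1\<^sub>m n"
      "1\<^sub>m n * 0\<^sub>m n m + 0\<^sub>m n m * 1\<^sub>m m = (0\<^sub>m n m :: 'a mat)"
      "X * 1\<^sub>m n + 1\<^sub>m m * - X = 0\<^sub>m m n"
      "X * 0\<^sub>m n m + 1\<^sub>m m * 1\<^sub>m m = 1\<^sub>m m"
      using X by (auto intro!: eq_matI)
    then show ?thesis
      by (subst mult_four_block_mat[OF one_carrier_mat zero_carrier_mat X one_carrier_mat
            one_carrier_mat zero_carrier_mat uminus_carrier_mat[OF X] one_carrier_mat]) simp
  qed
  show ?thesis
    using inverse[OF assms] inverse[OF uminus_carrier_mat[OF assms]]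
    by (intro invertible_matI[of _ "n + m" "four_block_mat (1\<^sub>m n) (0\<^sub>m n m) (- L) (1\<^sub>m m)"]) simp_all
qed

lemma invertible_mat_transpose:
  fixes P :: "'a :: comm_ring_1 mat"
  assumes "invertible_mat P"
  shows "invertible_mat (transpose_mat P)"
proof -
  define n where "n = dim_row P"
  have P: "P \<in> carrier_mat n n" using assms by (auto simp: invertible_mat_def n_def)
  obtain P' where P': "P' \<in> carrier_mat n n" "P * P' = 1\<^sub>m n" "P' * P = 1\<^sub>m n"
    using invertible_matE[OF assms P] .
  have "transpose_mat P * transpose_mat P' = 1\<^sub>m n" "transpose_mat P' * transpose_mat P = 1\<^sub>m n"
    by (simp_all only: transpose_mult[OF P P'(1), symmetric] transpose_mult[OF P'(1) P, symmetric]
        P'(2,3) transpose_one)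
  then show ?thesis using P P' by (intro invertible_matI[of _ n "transpose_mat P'"]) auto
qed

lemma invertible_upper_unitriangular:
  fixes R :: "'a :: comm_ring_1 mat"
  assumes R: "R \<in> carrier_mat m n"
  shows "invertible_mat (four_block_mat (1\<^sub>m m) R (0\<^sub>m n m) (1\<^sub>m n))"
proof -
  have "transpose_mat (four_block_mat (1\<^sub>m m) (0\<^sub>m m n) (transpose_mat R) (1\<^sub>m n))
      = four_block_mat (1\<^sub>m m) R (0\<^sub>m n m) (1\<^sub>m n)"
    using R by (subst transpose_four_block_mat[of _ m m _ n _ n]) auto
  with invertible_mat_transpose[OF invertible_lower_unitriangular[of "transpose_mat R" n m]] R
  show ?thesis by simp
qed

text \<open>
  With $L$ and $R$ the quotients of the first column and row by the corner $b$, the unitriangular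
  matrices with off-diagonal blocks $-L$ and $-R$ clear that column and row at once. The lower right
  block becomes the Schur complement.
\<close>

lemma mat_equivalent_corner:
  fixes B :: "int mat"
  assumes B: "B \<in> carrier_mat (Suc m) (Suc n)" and b: "B $$ (0, 0) = b"
    and row: "\<And>j. j < Suc n \<Longrightarrow> b dvd B $$ (0, j)"
    and col: "\<And>i. i < Suc m \<Longrightarrow> b dvd B $$ (i, 0)"
  shows "\<exists>C \<in> carrier_mat m n.
    mat_equivalent B (four_block_mat (mat 1 1 (\<lambda>_. b)) (0\<^sub>m 1 n) (0\<^sub>m m 1) C)"
proof -
  define M where "M = mat 1 1 (\<lambda>_. b)"
  define R where "R = mat 1 n (\<lambda>(_, j). B $$ (0, Suc j) div b)"
  define L where "L = mat m 1 (\<lambda>(i, _). B $$ (Suc i, 0) div b)"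
  define C0 where "C0 = mat m n (\<lambda>(i, j). B $$ (Suc i, Suc j))"
  have M: "M \<in> carrier_mat 1 1" and R: "R \<in> carrier_mat 1 n"
    and L: "L \<in> carrier_mat m 1" and C0: "C0 \<in> carrier_mat m n"
    by (simp_all add: M_def R_def L_def C0_def)
  have LM: "L * M \<in> carrier_mat m 1" using L M by (rule mult_carrier_mat)
  have MR: "M * R \<in> carrier_mat 1 n" using M R by (rule mult_carrier_mat)
  have LMR: "L * (M * R) \<in> carrier_mat m n" using L MR by (rule mult_carrier_mat)
  have B_eq: "B = four_block_mat M (M * R) (L * M) C0"
  proof (rule eq_matI)
    fix i j
    assume "i < dim_row (four_block_mat M (M * R) (L * M) C0)"
      "j < dim_col (four_block_mat M (M * R) (L * M) C0)"
    then have ij: "i < Suc m" "j < Suc n" by (simp_all add: M_def C0_def)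
    have "B $$ (0, Suc j') = b * (B $$ (0, Suc j') div b)" if "j' < n" for j'
      using row[of "Suc j'"] that by simp
    moreover have "B $$ (Suc i', 0) = B $$ (Suc i', 0) div b * b" if "i' < m" for i'
      using col[of "Suc i'"] that by simp
    ultimately show "B $$ (i, j) = four_block_mat M (M * R) (L * M) C0 $$ (i, j)"
      using ij b
      by (cases i; cases j)
        (auto simp: M_def R_def L_def C0_def scalar_prod_def)
  qed (use B in \<open>simp_all add: M_def C0_def\<close>)
  define P where "P = four_block_mat (1\<^sub>m 1) (0\<^sub>m 1 m) (- L) (1\<^sub>m m)"
  define Q where "Q = four_block_mat (1\<^sub>m 1) (- R) (0\<^sub>m n 1) (1\<^sub>m n)"
  define C where "C = C0 - L * (M * R)"
  have C: "C \<in> carrier_mat m n" unfolding C_def using LMR by (rule minus_carrier_mat)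
  have P: "P \<in> carrier_mat (1 + m) (1 + m)" and Q: "Q \<in> carrier_mat (1 + n) (1 + n)"
    unfolding P_def Q_def by (rule four_block_carrier_mat; simp)+
  have invP: "invertible_mat P" and invQ: "invertible_mat Q"
    unfolding P_def Q_def using L R
    by (simp_all add: invertible_lower_unitriangular invertible_upper_unitriangular del: One_nat_def)
  have "P * B = four_block_mat M (M * R) (0\<^sub>m m 1) C"
  proof -
    have "1\<^sub>m 1 * M + 0\<^sub>m 1 m * (L * M) = M"
      "1\<^sub>m 1 * (M * R) + 0\<^sub>m 1 m * C0 = M * R"
      "- L * M + 1\<^sub>m m * (L * M) = 0\<^sub>m m 1"
      "- L * (M * R) + 1\<^sub>m m * C0 = C"
      using L M R C0 LM MR LMR by (auto simp: C_def)
    then show ?thesis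
      unfolding P_def B_eq
      by (subst mult_four_block_mat[OF one_carrier_mat zero_carrier_mat uminus_carrier_mat[OF L]
            one_carrier_mat M MR LM C0]) simp
  qed
  also have "\<dots> * Q = four_block_mat M (0\<^sub>m 1 n) (0\<^sub>m m 1) C"
  proof -
    have "M * 1\<^sub>m 1 + M * R * 0\<^sub>m n 1 = M"
      "M * - R + M * R * 1\<^sub>m n = 0\<^sub>m 1 n"
      "0\<^sub>m m 1 * 1\<^sub>m 1 + C * 0\<^sub>m n 1 = 0\<^sub>m m 1"
      "0\<^sub>m m 1 * - R + C * 1\<^sub>m n = C"
      using M R C MR by (auto simp del: One_nat_def assoc_mult_mat)
    then show ?thesis
      unfolding Q_def
      by (subst mult_four_block_mat[OF M MR zero_carrier_mat C
            one_carrier_mat uminus_carrier_mat[OF R] zero_carrier_mat one_carrier_mat]) simp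
  qed
  finally have "mat_equivalent B (four_block_mat M (0\<^sub>m 1 n) (0\<^sub>m m 1) C)"
    using B P Q by (intro mat_equivalentI[OF _ _ invP _ invQ]) simp_all
  with C show ?thesis unfolding M_def by blast
qed

text \<open>
  Take for $b$ the least positive entry that occurs in any matrix equivalent to \<open>A\<close>. Whenever
  $b$ stands in the corner, it divides the first row and column, since a division with remainder,
  carried out as a column or row operation, would otherwise produce a smaller positive entry. After
  the first row and column are cleared, the same fact, applied once more, shows that $b$ divides the
  remaining block, which is the divisibility required of consecutive diagonal entries.
\<close>

lemma mat_equivalent_split_corner:
  fixes A :: "int mat"
  assumes A: "A \<in> carrier_mat (Suc m) (Suc n)"
    and nz: "i0 < Suc m" "j0 < Suc n" "A $$ (i0, j0) \<noteq> 0"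
  shows "\<exists>b > 0. \<exists>C \<in> carrier_mat m n. (\<forall>i < m. \<forall>j < n. b dvd C $$ (i, j)) \<and>
    mat_equivalent A (four_block_mat (mat 1 1 (\<lambda>_. b)) (0\<^sub>m 1 n) (0\<^sub>m m 1) C)"
proof -
  define E where "E b \<longleftrightarrow> b > 0 \<and> (\<exists>B i j. mat_equivalent A B \<and> i < Suc m \<and> j < Suc n \<and>
    B $$ (i, j) = int b)" for b
  have "\<exists>b. E b"
  proof (cases "A $$ (i0, j0) > 0")
    case True
    then show ?thesis using nz mat_equivalent_refl[of A]
      unfolding E_def by (intro exI[of _ "nat (A $$ (i0, j0))"]) auto
  next
    case False
    have "(- A) $$ (i0, j0) = - A $$ (i0, j0)" using A nz by simp
    with False show ?thesis using nz mat_equivalent_uminus[of A]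
      unfolding E_def by (intro exI[of _ "nat (- A $$ (i0, j0))"]) (auto intro!: exI[of _ "- A"])
  qed
  then have E: "E (LEAST b. E b)" by (metis LeastI)
  define b where "b = int (LEAST b. E b)"
  from E obtain B i j where B: "mat_equivalent A B" "i < Suc m" "j < Suc n" "B $$ (i, j) = b"
    and b: "b > 0"
    unfolding E_def b_def by auto
  have min: "b \<le> B $$ (i, j)"
    if "mat_equivalent A B" "i < Suc m" "j < Suc n" "B $$ (i, j) > 0" for B i j
  proof -
    have "E (nat (B $$ (i, j)))" using that unfolding E_def by auto
    then have "(LEAST b. E b) \<le> nat (B $$ (i, j))" by (rule Least_le)
    with that show ?thesis by (simp add: b_def nat_le_iff)
  qed
  have car: "B \<in> carrier_mat (Suc m) (Suc n)" if "mat_equivalent A B" for B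
    using that A by (rule mat_equivalent_carrier)
  have remainder: "b dvd x" if "mat_equivalent A B" "i < Suc m" "j < Suc n" "B $$ (i, j) = x mod b"
    for B i j x
    using min[OF that(1-3)] that(4) pos_mod_bound[OF b, of x] pos_mod_sign[OF b, of x]
    by (metis dvd_eq_mod_eq_0 linorder_not_le order_le_less)
  have row: "b dvd B $$ (0, j)"
    if AB: "mat_equivalent A B" and corner: "B $$ (0, 0) = b" and j: "j < Suc n" for B j
  proof (cases "j = 0")
    case False
    note B = car[OF AB]
    let ?B = "addcol (- (B $$ (0, j) div b)) j 0 B"
    have "mat_equivalent A ?B"
      by (rule mat_equivalent_trans[OF AB mat_equivalent_addcol[OF B j]]) (use False in auto)
    moreover have "?B $$ (0, j) = B $$ (0, j) mod b"
      using B j False corner by (simp add: minus_div_mult_eq_mod[symmetric])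
    ultimately show ?thesis using j by (intro remainder) auto
  qed (use corner in simp)
  have col: "b dvd B $$ (i, 0)"
    if AB: "mat_equivalent A B" and corner: "B $$ (0, 0) = b" and i: "i < Suc m" for B i
  proof (cases "i = 0")
    case False
    note B = car[OF AB]
    let ?B = "addrow (- (B $$ (i, 0) div b)) i 0 B"
    have "mat_equivalent A ?B"
      by (rule mat_equivalent_trans[OF AB mat_equivalent_addrow[OF B i]]) (use False in auto)
    moreover have "?B $$ (i, 0) = B $$ (i, 0) mod b"
      using B i False corner by (simp add: minus_div_mult_eq_mod[symmetric])
    ultimately show ?thesis using i by (intro remainder) auto
  qed (use corner in simp)
  define B1 where "B1 = swaprows 0 i (swapcols 0 j B)"
  have swap: "swapcols 0 j B \<in> carrier_mat (Suc m) (Suc n)"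
    using car[OF B(1)] by auto
  have B1: "mat_equivalent A B1"
    unfolding B1_def
    by (rule mat_equivalent_trans[OF mat_equivalent_trans[OF B(1)
          mat_equivalent_swapcols[OF car[OF B(1)]]] mat_equivalent_swaprows[OF swap]])
      (use B in auto)
  have corner: "B1 $$ (0, 0) = b"
    using car[OF B(1)] B by (simp add: B1_def)
  obtain C where C: "C \<in> carrier_mat m n"
    and equiv: "mat_equivalent B1 (four_block_mat (mat 1 1 (\<lambda>_. b)) (0\<^sub>m 1 n) (0\<^sub>m m 1) C)"
    using mat_equivalent_corner[OF car[OF B1] corner row[OF B1 corner] col[OF B1 corner]] by blast
  define D where "D = four_block_mat (mat 1 1 (\<lambda>_. b)) (0\<^sub>m 1 n) (0\<^sub>m m 1) C"
  have AD: "mat_equivalent A D"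
    unfolding D_def by (rule mat_equivalent_trans[OF B1 equiv])
  have "b dvd C $$ (i, j)" if ij: "i < m" "j < n" for i j
  proof -
    \<comment> \<open>Adding a lower row to the first one keeps the corner, because the first column is cleared.\<close>
    let ?D = "addrow 1 0 (Suc i) D"
    have "mat_equivalent A ?D"
      by (rule mat_equivalent_trans[OF AD mat_equivalent_addrow[OF car[OF AD]]]) (use ij in auto)
    moreover have "?D $$ (0, 0) = b" "?D $$ (0, Suc j) = C $$ (i, j)"
      using ij C by (auto simp: D_def)
    ultimately show ?thesis using row[of ?D "Suc j"] ij by simp
  qed
  with b C AD show ?thesis unfolding D_def by blast
qed

lemma triple_mult_entry:
  assumes "P \<in> carrier_mat m m" "A \<in> carrier_mat m n" "Q \<in> carrier_mat n n" "i < m" "j < n"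
  shows "(P * A * Q) $$ (i, j) = (\<Sum>l<n. (\<Sum>k<m. P $$ (i, k) * A $$ (k, l)) * Q $$ (l, j))"
  using assms by (simp add: scalar_prod_def atLeast0LessThan del: assoc_mult_mat)

text \<open>
  The split-off corner divides every entry of the remaining block, and this property survives
  equivalence, so the corner still divides the diagonal of the block's own normal form.
\<close>

theorem smith_normal_form_exists:
  fixes A :: "int mat"
  shows "\<exists>S. is_smith_normal_form A S"
proof (induction "dim_row A" arbitrary: A)
  case 0
  then show ?case
    using mat_equivalent_refl[of A] unfolding is_smith_normal_form_def mat_equivalent_def
    by (intro exI[of _ A]) (auto simp: diagonal_mat_def)
next
  case (Suc m)
  show ?case
  proof (cases "\<forall>i < dim_row A. \<forall>j < dim_col A. A $$ (i, j) = 0")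
    case True
    then show ?thesis
      using mat_equivalent_refl[of A] unfolding is_smith_normal_form_def mat_equivalent_def
      by (intro exI[of _ A]) (auto simp: diagonal_mat_def)
  next
    case False
    then obtain i0 j0 where nz: "i0 < dim_row A" "j0 < dim_col A" "A $$ (i0, j0) \<noteq> 0" by auto
    then obtain n where n: "dim_col A = Suc n" by (cases "dim_col A") auto
    have A: "A \<in> carrier_mat (Suc m) (Suc n)" using Suc n by auto
    obtain b C where b: "b > 0" and C: "C \<in> carrier_mat m n"
      and dvd: "\<And>i j. i < m \<Longrightarrow> j < n \<Longrightarrow> b dvd C $$ (i, j)"
      and AC: "mat_equivalent A (four_block_mat (mat 1 1 (\<lambda>_. b)) (0\<^sub>m 1 n) (0\<^sub>m m 1) C)"
      using mat_equivalent_split_corner[OF A, of i0 j0] nz A by auto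
    obtain T where T: "is_smith_normal_form C T" using Suc(1)[of C] C by auto
    then have CT: "mat_equivalent C T"
      unfolding is_smith_normal_form_def mat_equivalent_def by blast
    obtain P Q where PQ: "P \<in> carrier_mat m m" "Q \<in> carrier_mat n n"
      "T = P * C * Q" and Tc: "T \<in> carrier_mat m n"
      using mat_equivalentE[OF CT C] by metis
    have dvdT: "b dvd T $$ (i, j)" if "i < m" "j < n" for i j
      unfolding PQ(3) triple_mult_entry[OF PQ(1) C PQ(2) that]
      by (intro dvd_sum dvd_mult dvd_mult2 dvd) auto
    define S where "S = four_block_mat (mat 1 1 (\<lambda>_. b)) (0\<^sub>m 1 n) (0\<^sub>m m 1) T"
    have AS: "mat_equivalent A S"
      unfolding S_def
      by (rule mat_equivalent_trans[OF AC mat_equivalent_block_diag[OF CT C]]) simp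
    have S: "S \<in> carrier_mat (Suc m) (Suc n)" 
      unfolding S_def using four_block_carrier_mat[of "mat 1 1 (\<lambda>_. b)" 1 1 T m n] Tc by simp
    have S_entry: "S $$ (i, j) = (if i = 0 \<and> j = 0 then b else if i = 0 \<or> j = 0 then 0
        else T $$ (i - 1, j - 1))" if "i < Suc m" "j < Suc n" for i j
      using that Tc by (auto simp: S_def)
    have Tdiag: "T $$ (i, j) = 0" if "i < m" "j < n" "i \<noteq> j" for i j
      using T that Tc by (auto simp: is_smith_normal_form_def diagonal_mat_def)
    have Tnonneg: "T $$ (i, i) \<ge> 0" if "i < m" "i < n" for i
      using T that Tc by (auto simp: is_smith_normal_form_def)
    have Tdvd: "T $$ (i, i) dvd T $$ (Suc i, Suc i)" if "Suc i < m" "Suc i < n" for i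
      using T that Tc by (auto simp: is_smith_normal_form_def)
    have "diagonal_mat S"
      using S Tdiag by (auto simp: diagonal_mat_def S_entry)
    moreover have "S $$ (i, i) \<ge> 0" if "i < Suc m" "i < Suc n" for i
      using that b Tnonneg[of "i - 1"] by (auto simp: S_entry)
    moreover have "S $$ (i, i) dvd S $$ (Suc i, Suc i)" if "Suc i < Suc m" "Suc i < Suc n" for i
      using that Tdvd[of "i - 1"] dvdT by (auto simp: S_entry)
    ultimately have "is_smith_normal_form A S"
      using S A AS unfolding is_smith_normal_form_def mat_equivalent_def by auto
    then show ?thesis by blast
  qed
qed

section \<open>Uniqueness of the Smith normal form\<close>

text \<open>
  The $n$ equations in $n + 1$ unknowns, padded by a zero equation, have determinant zero. Dividing
  an integer solution by the greatest common divisor of its entries makes it primitive, so an integer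
  that divides $t$ times each entry divides $t$ itself.
\<close>

lemma primitive_kernel_vector:
  fixes f :: "nat \<Rightarrow> nat \<Rightarrow> int"
  shows "\<exists>y. Gcd (y ` {..n}) = 1 \<and> (\<forall>k < n. (\<Sum>j\<le>n. f k j * y j) = 0)"
proof -
  define M where "M = mat (Suc n) (Suc n) (\<lambda>(k, j). if k < n then f k j else 0)"
  have M: "M \<in> carrier_mat (Suc n) (Suc n)" by (simp add: M_def)
  \<comment> \<open>The last row of \<open>M\<close> is zero.\<close>
  have "transpose_mat M *\<^sub>v unit_vec (Suc n) n = 0\<^sub>v (Suc n)"
    by (rule eq_vecI) (simp_all add: M_def)
  then have "det (transpose_mat M) = 0"
    using M by (subst det_0_iff_vec_prod_zero[of _ "Suc n"])
      (auto intro!: exI[of _ "unit_vec (Suc n) n"])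
  then have "det M = 0" using M by (simp add: det_transpose)
  then obtain v where v: "v \<in> carrier_vec (Suc n)" "v \<noteq> 0\<^sub>v (Suc n)" "M *\<^sub>v v = 0\<^sub>v (Suc n)"
    using det_0_iff_vec_prod_zero[OF M] by blast
  define g where "g = Gcd ((\<lambda>j. v $ j) ` {..n})"
  define y where "y j = v $ j div g" for j
  have g: "g \<noteq> 0"
  proof
    assume "g = 0"
    then have "v $ j = 0" if "j < Suc n" for j
      using that unfolding g_def by (auto simp: Gcd_0_iff image_subset_iff less_Suc_eq_le)
    with v(1,2) show False by auto
  qed
  have gy: "v $ j = g * y j" if "j \<le> n" for j
    using that by (simp add: y_def g_def)
  have "normalize (g * Gcd (y ` {..n})) = Gcd ((*) g ` (y ` {..n}))" by (simp add: Gcd_mult)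
  also have "(*) g ` (y ` {..n}) = (\<lambda>j. v $ j) ` {..n}"
    unfolding image_image by (intro image_cong) (simp_all add: gy)
  also have "Gcd \<dots> = g * 1" by (simp add: g_def)
  finally have "Gcd (y ` {..n}) = 1"
    using g by (simp add: normalize_mult g_def)
  moreover have "(\<Sum>j\<le>n. f k j * y j) = 0" if "k < n" for k
  proof -
    have "(\<Sum>j\<le>n. f k j * v $ j) = (M *\<^sub>v v) $ k"
      using that v(1) by (simp add: M_def scalar_prod_def atLeast0LessThan lessThan_Suc_atMost)
    also have "\<dots> = 0" using that v by simp
    also have "(\<Sum>j\<le>n. f k j * v $ j) = g * (\<Sum>j\<le>n. f k j * y j)"
      unfolding sum_distrib_left by (rule sum.cong) (simp_all add: gy)
    finally show ?thesis using g by simp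
  qed
  ultimately show ?thesis by blast
qed

lemma dvd_chain_le:
  fixes s :: "nat \<Rightarrow> 'a :: comm_monoid_mult"
  assumes "\<And>i. Suc i < n \<Longrightarrow> s i dvd s (Suc i)" "i \<le> j" "j < n"
  shows "s i dvd s j"
  using assms(2,3)
proof (induction j rule: dec_induct)
  case (step j)
  then show ?case using assms(1)[of j] by (auto intro: dvd_trans)
qed simp

lemma diagonal_triple_mult_entry:
  fixes P :: "int mat"
  assumes "P \<in> carrier_mat m m" "S \<in> carrier_mat m n" "Q \<in> carrier_mat n n" "i < m" "j < n"
    and "diagonal_mat S"
  shows "(P * S * Q) $$ (i, j) = (\<Sum>k<min m n. P $$ (i, k) * S $$ (k, k) * Q $$ (k, j))"
proof -
  have "(\<Sum>k<m. P $$ (i, k) * S $$ (k, l)) = (if l < m then P $$ (i, l) * S $$ (l, l) else 0)"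
    if "l < n" for l
  proof -
    have "(\<Sum>k<m. P $$ (i, k) * S $$ (k, l)) = (\<Sum>k<m. if l = k then P $$ (i, k) * S $$ (k, k) else 0)"
      using assms(2,6) that by (intro sum.cong) (auto simp: diagonal_mat_def)
    then show ?thesis by simp
  qed
  then have "(P * S * Q) $$ (i, j) =
      (\<Sum>l<n. if l \<in> {..<m} then P $$ (i, l) * S $$ (l, l) * Q $$ (l, j) else 0)"
    unfolding triple_mult_entry[OF assms(1-5)] by (intro sum.cong) auto
  also have "\<dots> = (\<Sum>l\<in>{..<n} \<inter> {..<m}. P $$ (i, l) * S $$ (l, l) * Q $$ (l, j))"
    by (rule sum.inter_restrict[symmetric]) simp
  also have "{..<n} \<inter> {..<m} = {..<min m n}" by auto
  finally show ?thesis .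
qed

text \<open>
  Write $s_k$ and $t_k$ for the diagonal entries. If $t_i \neq 0$, then \<open>e j = t_i / t_j\<close> is an
  integer for $j \le i$. A primitive vector $y$ on the first $i + 1$ coordinates can be chosen such
  that the first $i$ coordinates of $Q z$ vanish, where \<open>z j = e j * y j\<close>. Then $S Q z$ only
  involves $s_k$ with $k \ge i$, so $s_i$ divides $T z = P S Q z$, whose first $i + 1$ coordinates
  are $t_i y_r$. As $y$ is primitive, $s_i$ divides $t_i$.
\<close>

lemma diagonal_entry_dvd:
  fixes S T :: "int mat"
  assumes S: "S \<in> carrier_mat m n" "diagonal_mat S"
      "\<And>i. Suc i < min m n \<Longrightarrow> S $$ (i, i) dvd S $$ (Suc i, Suc i)"
    and T: "T \<in> carrier_mat m n" "diagonal_mat T"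
      "\<And>i. Suc i < min m n \<Longrightarrow> T $$ (i, i) dvd T $$ (Suc i, Suc i)"
    and PQ: "P \<in> carrier_mat m m" "Q \<in> carrier_mat n n" "T = P * S * Q"
    and i: "i < min m n"
  shows "S $$ (i, i) dvd T $$ (i, i)"
proof (cases "T $$ (i, i) = 0")
  case False
  define s t where "s k = S $$ (k, k)" and "t k = T $$ (k, k)" for k
  have s: "s k dvd s l" if "k \<le> l" "l < min m n" for k l
    using dvd_chain_le[of "min m n" s] S(3) that unfolding s_def by blast
  have t: "t k dvd t l" if "k \<le> l" "l < min m n" for k l
    using dvd_chain_le[of "min m n" t] T(3) that unfolding t_def by blast
  define e where "e j = t i div t j" for j
  have te: "t j * e j = t i" if "j \<le> i" for j
    using t[of j i] i that by (simp add: e_def)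
  obtain y where y: "Gcd (y ` {..i}) = 1"
    and ker: "\<And>k. k < i \<Longrightarrow> (\<Sum>j\<le>i. Q $$ (k, j) * e j * y j) = 0"
    using primitive_kernel_vector[of i "\<lambda>k j. Q $$ (k, j) * e j"] by blast
  have "s i dvd t i * y r" if r: "r \<le> i" for r
  proof -
    have "t i * y r = (\<Sum>j\<le>i. if r = j then t j * e j * y j else 0)"
      using r te by simp
    also have "\<dots> = (\<Sum>j\<le>i. T $$ (r, j) * e j * y j)"
      using T(1,2) i r by (intro sum.cong) (auto simp: diagonal_mat_def t_def)
    also have "\<dots> = (\<Sum>j\<le>i. (\<Sum>k<min m n. P $$ (r, k) * s k * Q $$ (k, j)) * e j * y j)"
      unfolding PQ(3) s_def using i r
      by (intro sum.cong refl) (subst diagonal_triple_mult_entry[OF PQ(1) S(1) PQ(2) _ _ S(2)], auto)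
    also have "\<dots> = (\<Sum>j\<le>i. \<Sum>k<min m n. P $$ (r, k) * s k * (Q $$ (k, j) * e j * y j))"
      by (simp add: sum_distrib_right mult.assoc)
    also have "\<dots> = (\<Sum>k<min m n. P $$ (r, k) * s k * (\<Sum>j\<le>i. Q $$ (k, j) * e j * y j))"
      by (subst sum.swap) (simp add: sum_distrib_left)
    also have "s i dvd \<dots>"
    proof (rule dvd_sum)
      fix k assume "k \<in> {..<min m n}"
      then show "s i dvd P $$ (r, k) * s k * (\<Sum>j\<le>i. Q $$ (k, j) * e j * y j)"
        using ker[of k] s[of i k] by (cases "k < i") auto
    qed
    finally show ?thesis .
  qed
  then have "s i dvd Gcd ((*) (t i) ` (y ` {..i}))" by (intro Gcd_greatest) auto
  then show ?thesis using y by (simp add: Gcd_mult s_def t_def)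
qed simp

theorem smith_normal_form_unique:
  assumes "is_smith_normal_form A S" "is_smith_normal_form A T"
  shows "S = T"
proof -
  define m n where "m = dim_row A" and "n = dim_col A"
  have dvd: "S $$ (i, i) dvd T $$ (i, i)"
    if S: "is_smith_normal_form A S" and T: "is_smith_normal_form A T" and i: "i < min m n" for S T i
  proof -
    have "mat_equivalent A S" "mat_equivalent A T"
      using S T unfolding is_smith_normal_form_def mat_equivalent_def by blast+
    then have "mat_equivalent S T" using mat_equivalent_sym mat_equivalent_trans by blast
    moreover have Sc: "S \<in> carrier_mat m n" and Tc: "T \<in> carrier_mat m n"
      using S T unfolding is_smith_normal_form_def m_def n_def by blast+
    ultimately obtain P Q where "P \<in> carrier_mat m m" "Q \<in> carrier_mat n n" "T = P * S * Q"
      using mat_equivalentE by metis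
    then show ?thesis
      using S T Sc Tc i
      by (intro diagonal_entry_dvd[OF Sc _ _ Tc]) (auto simp: is_smith_normal_form_def)
  qed
  show ?thesis
  proof (rule eq_matI)
    fix i j assume "i < dim_row T" "j < dim_col T"
    then have ij: "i < m" "j < n"
      using assms by (auto simp: is_smith_normal_form_def m_def n_def)
    show "S $$ (i, j) = T $$ (i, j)"
    proof (cases "i = j")
      case True
      then have "S $$ (i, i) dvd T $$ (i, i)" "T $$ (i, i) dvd S $$ (i, i)"
        using dvd assms ij by auto
      moreover have "S $$ (i, i) \<ge> 0" "T $$ (i, i) \<ge> 0"
        using assms ij True by (auto simp: is_smith_normal_form_def m_def n_def)
      ultimately show ?thesis using True by (simp add: zdvd_antisym_nonneg)
    next
      case False
      then show ?thesis
        using assms ij by (auto simp: is_smith_normal_form_def diagonal_mat_def m_def n_def)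
    qed
  qed (use assms in \<open>auto simp: is_smith_normal_form_def\<close>)
qed

corollary smith_normal_form: "is_smith_normal_form A (smith_normal_form A)"
  unfolding smith_normal_form_def
  by (rule theI') (use smith_normal_form_exists smith_normal_form_unique in blast)

section \<open>Zero-one matrices with a single unit invariant factor\<close>

lemma count_invariant_factors:
  assumes "is_smith_normal_form A S"
  shows "count_list (invariant_factors A) d
    = card {i. i < min (dim_row A) (dim_col A) \<and> S $$ (i, i) = d}"
proof -
  have "smith_normal_form A = S" using smith_normal_form_unique[OF smith_normal_form assms] .
  then show ?thesis
    by (auto simp: invariant_factors_def count_list_eq_length_filter length_filter_conv_card
        intro!: arg_cong[of _ _ card])
qed

lemma zero_one_minor_vanishes:
  fixes a b c e d :: int
  assumes "a \<in> {0, 1}" "b \<in> {0, 1}" "c \<in> {0, 1}" "e \<in> {0, 1}"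
    and "d dvd a * e - b * c" "d \<ge> 0" "d \<noteq> 1"
  shows "a * e = b * c"
  using assms by (auto simp: zdvd1_eq)

text \<open>
  In one direction the second invariant factor divides the $2$-minors, which therefore vanish; in the
  other one the Smith normal form has rank one like the matrix, so its first diagonal entry, which
  is $1$ because it divides an entry $1$, has product zero with every later one.
\<close>

lemma zero_one_mat_one_unit_invariant_factor_iff:
  fixes A :: "int mat"
  assumes A: "A \<in> carrier_mat m n"
    and zero_one: "\<And>i j. i < m \<Longrightarrow> j < n \<Longrightarrow> A $$ (i, j) \<in> {0, 1}"
  shows "count_list (invariant_factors A) 1 = 1 \<longleftrightarrow>
    (\<exists>X Y. X \<noteq> {} \<and> Y \<noteq> {} \<and> X \<subseteq> {..<m} \<and> Y \<subseteq> {..<n} \<and>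
      (\<forall>i < m. \<forall>j < n. A $$ (i, j) = of_bool (i \<in> X \<and> j \<in> Y)))"
proof -
  define S where "S = smith_normal_form A"
  have smith: "is_smith_normal_form A S" unfolding S_def by (rule smith_normal_form)
  then have S: "S \<in> carrier_mat m n" "diagonal_mat S"
    using A by (auto simp: is_smith_normal_form_def)
  define N where "N = min m n"
  define s where "s k = S $$ (k, k)" for k
  have nonneg: "s i \<ge> 0" if "i < N" for i
    using smith that S(1) by (auto simp: is_smith_normal_form_def N_def s_def)
  have "s i dvd s (Suc i)" if "Suc i < N" for i
    using smith that S(1) by (auto simp: is_smith_normal_form_def N_def s_def)
  then have chain: "s i dvd s j" if "i \<le> j" "j < N" for i j
    using dvd_chain_le[of N s] that by blast
  have count: "count_list (invariant_factors A) 1 = card {i. i < N \<and> s i = 1}"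
    using count_invariant_factors[OF smith] A by (auto simp: N_def s_def)
  have AS: "mat_equivalent A S"
    using smith unfolding is_smith_normal_form_def mat_equivalent_def by blast
  show ?thesis
  proof
    assume "count_list (invariant_factors A) 1 = 1"
    then obtain k where k: "{i. i < N \<and> s i = 1} = {k}"
      by (auto simp: count card_1_singleton_iff)
    then have sk: "k < N" "s k = 1" by blast+
    have "s 0 dvd 1" using chain[of 0 k] sk by simp
    then have s0: "s 0 = 1" using nonneg[of 0] sk by (simp add: zdvd1_eq)
    have "0 \<in> {i. i < N \<and> s i = 1}" using s0 sk by simp
    then have k0: "k = 0" unfolding k by simp
    have s1: "s 1 \<noteq> 1" if "1 < N"
    proof
      assume "s 1 = 1"
      with that have "1 \<in> {i. i < N \<and> s i = 1}" by simp
      then show False unfolding k k0 by simp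
    qed
    \<comment> \<open>The value $0$ reflects that the minors vanish outright for a single row or column.\<close>
    define d where "d = (if 1 < N then s 1 else 0)"
    have d: "d \<ge> 0" "d \<noteq> 1"
      using nonneg[of 1] s1 by (simp_all add: d_def)
    have d_dvd: "d dvd s l" if "0 < l" "l < N" for l
      using chain[of 1 l] that by (auto simp: d_def)
    obtain P Q where PQ: "P \<in> carrier_mat m m" "Q \<in> carrier_mat n n" "A = P * S * Q"
      using mat_equivalentE[OF mat_equivalent_sym[OF AS] S(1)] by metis
    \<comment> \<open>Modulo \<open>d\<close>, only the first diagonal entry of \<open>S\<close> contributes to \<open>A\<close>.\<close>
    define u v where "u i = P $$ (i, 0) * s 0" and "v j = Q $$ (0, j)" for i j
    have cong: "d dvd A $$ (i, j) - u i * v j" if "i < m" "j < n" for i j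
    proof -
      have "A $$ (i, j) = (\<Sum>l<N. P $$ (i, l) * s l * Q $$ (l, j))"
        unfolding PQ(3) N_def s_def by (rule diagonal_triple_mult_entry[OF PQ(1) S(1) PQ(2) that S(2)])
      also have "\<dots> = u i * v j + (\<Sum>l\<in>{..<N} - {0}. P $$ (i, l) * s l * Q $$ (l, j))"
        using sk k0 by (subst sum.remove[of _ 0]) (auto simp: u_def v_def)
      finally have "A $$ (i, j) - u i * v j = (\<Sum>l\<in>{..<N} - {0}. P $$ (i, l) * s l * Q $$ (l, j))"
        by simp
      also have "d dvd \<dots>"
        by (intro dvd_sum dvd_mult2 dvd_mult d_dvd) auto
      finally show ?thesis .
    qed
    define w where "w i j = (A $$ (i, j) - u i * v j) div d" for i j
    have w: "A $$ (i, j) = u i * v j + d * w i j" if "i < m" "j < n" for i j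
      using cong[OF that] by (simp add: w_def)
    have minor: "A $$ (i, j) * A $$ (i', j') = A $$ (i, j') * A $$ (i', j)"
      if "i < m" "i' < m" "j < n" "j' < n" for i i' j j'
    proof (rule zero_one_minor_vanishes[OF _ _ _ _ _ d])
      have "A $$ (i, j) * A $$ (i', j') - A $$ (i, j') * A $$ (i', j) =
        d * (u i * v j * w i' j' + w i j * u i' * v j' + d * w i j * w i' j'
          - u i * v j' * w i' j - w i j' * u i' * v j - d * w i j' * w i' j)"
        using that by (simp add: w algebra_simps)
      then show "d dvd A $$ (i, j) * A $$ (i', j') - A $$ (i, j') * A $$ (i', j)" by simp
    qed (use that zero_one in auto)
    define X where "X = {i. i < m \<and> (\<exists>j<n. A $$ (i, j) = 1)}"
    define Y where "Y = {j. j < n \<and> (\<exists>i<m. A $$ (i, j) = 1)}"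
    have "\<exists>i<m. \<exists>j<n. A $$ (i, j) = 1"
    proof (rule ccontr)
      assume "\<not> ?thesis"
      then have zero: "A $$ (i, j) = 0" if "i < m" "j < n" for i j using zero_one[OF that] that by auto
      obtain P Q where PQ: "P \<in> carrier_mat m m" "Q \<in> carrier_mat n n" "S = P * A * Q"
        using mat_equivalentE[OF AS A] by metis
      have "0 < m" "0 < n" using sk by (auto simp: N_def)
      then have "s 0 = 0"
        unfolding s_def PQ(3) by (subst triple_mult_entry[OF PQ(1) A PQ(2)]) (auto simp: zero)
      with s0 show False by simp
    qed
    then have "X \<noteq> {}" "Y \<noteq> {}" by (auto simp: X_def Y_def)
    moreover have "A $$ (i, j) = of_bool (i \<in> X \<and> j \<in> Y)" if ij: "i < m" "j < n" for i j
    proof (cases "i \<in> X \<and> j \<in> Y")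
      case True
      then obtain i' j' where "i' < m" "j' < n" "A $$ (i, j') = 1" "A $$ (i', j) = 1"
        by (auto simp: X_def Y_def)
      with minor[of i i' j j'] ij have "A $$ (i, j) * A $$ (i', j') = 1" by simp
      with zero_one[OF ij] True show ?thesis by auto
    next
      case False
      with zero_one[OF ij] ij show ?thesis by (auto simp: X_def Y_def)
    qed
    moreover have "X \<subseteq> {..<m}" "Y \<subseteq> {..<n}" by (auto simp: X_def Y_def)
    ultimately show "\<exists>X Y. X \<noteq> {} \<and> Y \<noteq> {} \<and> X \<subseteq> {..<m} \<and> Y \<subseteq> {..<n} \<and>
      (\<forall>i < m. \<forall>j < n. A $$ (i, j) = of_bool (i \<in> X \<and> j \<in> Y))"
      by (intro exI[of _ X] exI[of _ Y] conjI allI impI) simp_all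
  next
    assume "\<exists>X Y. X \<noteq> {} \<and> Y \<noteq> {} \<and> X \<subseteq> {..<m} \<and> Y \<subseteq> {..<n} \<and>
      (\<forall>i < m. \<forall>j < n. A $$ (i, j) = of_bool (i \<in> X \<and> j \<in> Y))"
    then obtain X Y where ne: "X \<noteq> {}" "Y \<noteq> {}" and XY: "X \<subseteq> {..<m}" "Y \<subseteq> {..<n}"
      and A_eq': "\<forall>i < m. \<forall>j < n. A $$ (i, j) = of_bool (i \<in> X \<and> j \<in> Y)"
      by (elim exE conjE) (rule that)
    obtain i0 j0 where ij: "i0 \<in> X" "j0 \<in> Y" using ne by blast
    have A_eq: "A $$ (i, j) = of_bool (i \<in> X) * of_bool (j \<in> Y)" if "i < m" "j < n" for i j
      using A_eq' that by (simp add: of_bool_conj)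
    have ij0: "i0 < m" "j0 < n" using XY ij by auto
    then have N: "0 < N" by (auto simp: N_def)
    have "s 0 dvd 1"
    proof -
      obtain P Q where PQ: "P \<in> carrier_mat m m" "Q \<in> carrier_mat n n" "A = P * S * Q"
        using mat_equivalentE[OF mat_equivalent_sym[OF AS] S(1)] by metis
      have "s 0 dvd A $$ (i0, j0)"
        unfolding PQ(3) diagonal_triple_mult_entry[OF PQ(1) S(1) PQ(2) ij0 S(2)]
          s_def[symmetric] N_def[symmetric]
        by (intro dvd_sum dvd_mult2 dvd_mult chain) auto
      then show ?thesis using A_eq[OF ij0] ij by simp
    qed
    then have s0: "s 0 = 1" using nonneg[OF N] by auto
    have "s i \<noteq> 1" if i: "0 < i" "i < N" for i
    proof -
      obtain P Q where PQ: "P \<in> carrier_mat m m" "Q \<in> carrier_mat n n" "S = P * A * Q"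
        using mat_equivalentE[OF AS A] by metis
      define u v where "u i = (\<Sum>k<m. P $$ (i, k) * of_bool (k \<in> X))"
        and "v j = (\<Sum>l<n. of_bool (l \<in> Y) * Q $$ (l, j))" for i j
      have uv: "S $$ (i, j) = u i * v j" if "i < m" "j < n" for i j
      proof -
        have "S $$ (i, j) = (\<Sum>l<n. (\<Sum>k<m. P $$ (i, k) * A $$ (k, l)) * Q $$ (l, j))"
          unfolding PQ(3) by (rule triple_mult_entry[OF PQ(1) A PQ(2) that])
        also have "\<dots> = (\<Sum>l<n. u i * of_bool (l \<in> Y) * Q $$ (l, j))"
          unfolding u_def sum_distrib_right
          by (intro sum.cong refl) (simp add: A_eq mult.assoc)
        also have "\<dots> = u i * v j" by (simp only: v_def sum_distrib_left mult.assoc)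
        finally show ?thesis .
      qed
      have "s 0 * s i = (u 0 * v i) * (u i * v 0)"
        using i by (simp add: s_def uv N_def algebra_simps)
      also have "u 0 * v i = S $$ (0, i)" using i by (simp add: uv N_def)
      also have "\<dots> = 0" using i S by (auto simp: diagonal_mat_def N_def)
      finally show ?thesis using s0 by simp
    qed
    then have "{i. i < N \<and> s i = 1} = {0}" using s0 N by (auto intro: gr0I)
    then show "count_list (invariant_factors A) 1 = 1" by (simp add: count)
  qed
qed

section \<open>Digraphs whose arcs form a product set\<close>

lemma adjacency_mat_entry:
  assumes "nomulti_digraph D" "i < length vs" "j < length vs"
  shows "adjacency_mat D vs $$ (i, j) = of_bool ((vs ! i, vs ! j) \<in> arcs_ends D)"
proof -
  interpret nomulti_digraph D by fact
  let ?E = "{e \<in> arcs D. tail D e = vs ! i \<and> head D e = vs ! j}"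
  have "card ?E = of_bool (?E \<noteq> {})"
  proof (cases "?E = {}")
    case True
    show ?thesis unfolding True by simp
  next
    case False
    then obtain e where e: "e \<in> ?E" by blast
    have "?E = {e}"
      using e by (auto simp: arc_to_ends_def intro: no_multi_arcs)
    then show ?thesis by simp
  qed
  also have "?E \<noteq> {} \<longleftrightarrow> (vs ! i, vs ! j) \<in> arcs_ends D"
    by (force simp: arcs_ends_conv image_iff)
  finally show ?thesis using assms by (simp add: adjacency_mat_def)
qed

lemma one_unit_invariant_factor_iff_arcs_ends_product:
  assumes "nomulti_digraph D" "set vs = verts D"
  shows "count_list (invariant_factors (adjacency_mat D vs)) 1 = 1 \<longleftrightarrow>
    (\<exists>X Y. X \<noteq> {} \<and> Y \<noteq> {} \<and> arcs_ends D = X \<times> Y)"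
proof -
  interpret nomulti_digraph D by fact
  define n where "n = length vs"
  have A: "adjacency_mat D vs \<in> carrier_mat n n" by (simp add: adjacency_mat_def n_def)
  have entry: "adjacency_mat D vs $$ (i, j) = of_bool ((vs ! i, vs ! j) \<in> arcs_ends D)"
    if "i < n" "j < n" for i j
    using adjacency_mat_entry[OF assms(1)] that by (simp add: n_def)
  have ends: "arcs_ends D \<subseteq> set vs \<times> set vs"
    unfolding assms(2) arcs_ends_conv by auto
  have "adjacency_mat D vs $$ (i, j) \<in> {0, 1}" if "i < n" "j < n" for i j
    using entry[OF that] by simp
  note iff = zero_one_mat_one_unit_invariant_factor_iff[OF A this]
  have entry_eq: "adjacency_mat D vs $$ (i, j) = of_bool b \<longleftrightarrow> ((vs ! i, vs ! j) \<in> arcs_ends D \<longleftrightarrow> b)"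
    if "i < n" "j < n" for i j b
    using entry[OF that] by (simp only: of_bool_eq_iff)
  have eq: "(\<forall>i < n. \<forall>j < n. adjacency_mat D vs $$ (i, j) = of_bool (i \<in> X \<and> j \<in> Y)) \<longleftrightarrow>
      (\<forall>i < n. \<forall>j < n. (vs ! i, vs ! j) \<in> arcs_ends D \<longleftrightarrow> i \<in> X \<and> j \<in> Y)" for X Y
    by (simp add: entry_eq)
  have "count_list (invariant_factors (adjacency_mat D vs)) 1 = 1 \<longleftrightarrow>
    (\<exists>X Y. X \<noteq> {} \<and> Y \<noteq> {} \<and> X \<subseteq> {..<n} \<and> Y \<subseteq> {..<n} \<and>
      (\<forall>i < n. \<forall>j < n. (vs ! i, vs ! j) \<in> arcs_ends D \<longleftrightarrow> i \<in> X \<and> j \<in> Y))"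
    by (simp only: iff eq)
  also have "\<dots> \<longleftrightarrow> (\<exists>X Y. X \<noteq> {} \<and> Y \<noteq> {} \<and> arcs_ends D = X \<times> Y)"
  proof (intro iffI; elim exE conjE)
    fix X Y assume XY: "X \<noteq> {}" "Y \<noteq> {}" "X \<subseteq> {..<n}" "Y \<subseteq> {..<n}"
      "\<forall>i < n. \<forall>j < n. (vs ! i, vs ! j) \<in> arcs_ends D \<longleftrightarrow> i \<in> X \<and> j \<in> Y"
    have prod: "arcs_ends D = (!) vs ` X \<times> (!) vs ` Y"
    proof
      show "arcs_ends D \<subseteq> (!) vs ` X \<times> (!) vs ` Y"
      proof (rule subrelI)
        fix a b assume ab: "(a, b) \<in> arcs_ends D"
        then have "a \<in> set vs" "b \<in> set vs" using ends by auto
        then obtain i j where ij: "i < n" "j < n" "a = vs ! i" "b = vs ! j"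
          unfolding n_def by (metis in_set_conv_nth)
        with ab have "i \<in> X \<and> j \<in> Y" using XY(5) by blast
        then show "(a, b) \<in> (!) vs ` X \<times> (!) vs ` Y" using ij by blast
      qed
      show "(!) vs ` X \<times> (!) vs ` Y \<subseteq> arcs_ends D" using XY(3-5) by blast
    qed
    show "\<exists>X Y. X \<noteq> {} \<and> Y \<noteq> {} \<and> arcs_ends D = X \<times> Y"
      by (intro exI[of _ "(!) vs ` X"] exI[of _ "(!) vs ` Y"] conjI prod) (simp_all add: XY(1,2))
  next
    fix X Y assume XY: "X \<noteq> {}" "Y \<noteq> {}" "arcs_ends D = X \<times> Y"
    have "X \<times> Y \<subseteq> set vs \<times> set vs" using ends by (simp only: XY(3))
    then have sub: "X \<subseteq> set vs" "Y \<subseteq> set vs" using XY(1,2) by (simp_all add: times_subset_iff)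
    have ne: "{i. i < n \<and> vs ! i \<in> Z} \<noteq> {}" if Z: "Z \<noteq> {}" "Z \<subseteq> set vs" for Z
    proof -
      obtain z where "z \<in> Z" "z \<in> set vs" using Z by blast
      then show ?thesis unfolding n_def by (metis (mono_tags, lifting) empty_Collect_eq in_set_conv_nth)
    qed
    show "\<exists>X Y. X \<noteq> {} \<and> Y \<noteq> {} \<and> X \<subseteq> {..<n} \<and> Y \<subseteq> {..<n} \<and>
      (\<forall>i < n. \<forall>j < n. (vs ! i, vs ! j) \<in> arcs_ends D \<longleftrightarrow> i \<in> X \<and> j \<in> Y)"
      by (rule exI[of _ "{i. i < n \<and> vs ! i \<in> X}"], rule exI[of _ "{i. i < n \<and> vs ! i \<in> Y}"],
          intro conjI ne XY(1,2) sub) (auto simp: XY(3))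
  qed
  finally show ?thesis .
qed

text \<open>
  The two ends of an arc are distinct, so every vertex is joined by an undirected walk to one of them
  that differs from itself, and the first step of that walk uses an incident arc.
\<close>

lemma connected_verts_eq_Domain_Un_Range:
  assumes "digraph D" "Digraph_Component.connected D" "arcs_ends D \<noteq> {}"
  shows "verts D = Domain (arcs_ends D) \<union> Range (arcs_ends D)"
proof
  interpret digraph D by fact
  show "Domain (arcs_ends D) \<union> Range (arcs_ends D) \<subseteq> verts D"
    by (auto simp: arcs_ends_conv)
  show "verts D \<subseteq> Domain (arcs_ends D) \<union> Range (arcs_ends D)"
  proof
    fix v assume v: "v \<in> verts D"
    obtain e where e: "e \<in> arcs D" using assms(3) by (auto simp: arcs_ends_conv)
    then obtain w where w: "w \<in> verts D" "w \<noteq> v"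
      using no_loops[OF e] by (metis head_in_verts tail_in_verts)
    have "(v, w) \<in> rtrancl_on (verts D) ((arcs_ends D)\<^sup>s)"
      using assms(2) v w(1) by (simp add: connected_conv)
    then have "(v, w) \<in> ((arcs_ends D)\<^sup>s)\<^sup>*" by (rule rtrancl_on_rtranclI)
    then obtain u where "(v, u) \<in> (arcs_ends D)\<^sup>s"
      using w(2) by (metis converse_rtranclE)
    then show "v \<in> Domain (arcs_ends D) \<union> Range (arcs_ends D)" by (auto simp: symcl_def)
  qed
qed

lemma Lambda_digraph_simps:
  "verts (Lambda_digraph n1 n2 n3) = VT ` {..<n1} \<union> VK ` {..<n2} \<union> VT' ` {..<n3}"
  "arcs_ends (Lambda_digraph n1 n2 n3) =
     {(u, v). u \<in> VK ` {..<n2} \<and> v \<in> VK ` {..<n2} \<and> u \<noteq> v}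
     \<union> VT ` {..<n1} \<times> VK ` {..<n2} \<union> VT ` {..<n1} \<times> VT' ` {..<n3} \<union> VK ` {..<n2} \<times> VT' ` {..<n3}"
  unfolding Lambda_digraph_def Let_def by simp_all

text \<open>
  \<open>X\<close> and \<open>Y\<close> partition the vertices, so any enumerations of the two sets combine to an
  isomorphism. Arcs are sent to the pairs of images of their ends, injectively because there are no
  parallel arcs.
\<close>

lemma digraph_iso_Lambda_digraph_of_arcs_ends_product:
  assumes "digraph D" "Digraph_Component.connected D"
    and XY: "X \<noteq> {}" "Y \<noteq> {}" "arcs_ends D = X \<times> Y"
  shows "digraph_iso D (Lambda_digraph (card X) 0 (card Y))"
proof -
  interpret digraph D by fact
  have disj: "X \<inter> Y = {}" using XY(3) no_loops by (force simp: arcs_ends_conv)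
  have verts: "verts D = X \<union> Y"
    using connected_verts_eq_Domain_Un_Range[OF assms(1,2)] XY by auto
  have "finite (X \<union> Y)" using finite_verts by (simp only: verts)
  then have "finite X" "finite Y" by auto
  then obtain g h where g: "bij_betw g X {0..<card X}" and h: "bij_betw h Y {0..<card Y}"
    using ex_bij_betw_finite_nat by meson
  define f where "f x = (if x \<in> X then VT (g x) else VT' (h x))" for x
  have "f ` X = VT ` (g ` X)"
    unfolding image_image by (intro image_cong) (simp_all add: f_def)
  then have fX: "f ` X = VT ` {..<card X}"
    using bij_betw_imp_surj_on[OF g] by (simp add: atLeast0LessThan)
  have "f y = VT' (h y)" if "y \<in> Y" for y
    using disj that by (auto simp: f_def)
  then have "f ` Y = VT' ` (h ` Y)"
    unfolding image_image by (intro image_cong) simp_all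
  then have fY: "f ` Y = VT' ` {..<card Y}"
    using bij_betw_imp_surj_on[OF h] by (simp add: atLeast0LessThan)
  have inj: "inj_on f (X \<union> Y)"
    using bij_betw_imp_inj_on[OF g] bij_betw_imp_inj_on[OF h]
    by (auto simp: inj_on_def f_def)
  define \<phi> where "\<phi> = \<lparr>iso_verts = f, iso_arcs = (\<lambda>e. (f (tail D e), f (head D e))),
    iso_head = snd, iso_tail = fst\<rparr>"
  have "inj_on (\<lambda>e. (f (tail D e), f (head D e))) (arcs D)"
  proof (rule inj_onI)
    fix e e' assume e: "e \<in> arcs D" "e' \<in> arcs D"
      "(f (tail D e), f (head D e)) = (f (tail D e'), f (head D e'))"
    then have "tail D e = tail D e'" "head D e = head D e'"
      using inj verts tail_in_verts head_in_verts by (metis Pair_inject inj_onD)+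
    then show "e = e'" using e no_multi_arcs by (simp add: arc_to_ends_def)
  qed
  then have "digraph_isomorphism \<phi>"
    using inj verts wf_digraph unfolding digraph_isomorphism_def \<phi>_def by simp
  moreover have "Lambda_digraph (card X) 0 (card Y) = app_iso \<phi> D"
  proof -
    have "(\<lambda>e. (f (tail D e), f (head D e))) ` arcs D = map_prod f f ` arcs_ends D"
      by (auto simp: arcs_ends_conv image_image)
    also have "\<dots> = f ` X \<times> f ` Y"
      unfolding XY(3) by force
    also have "\<dots> = VT ` {..<card X} \<times> VT' ` {..<card Y}"
      unfolding fX fY ..
    finally have "(\<lambda>e. (f (tail D e), f (head D e))) ` arcs D = VT ` {..<card X} \<times> VT' ` {..<card Y}" .
    moreover have "f ` verts D = VT ` {..<card X} \<union> VT' ` {..<card Y}"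
      unfolding verts image_Un fX fY ..
    ultimately show ?thesis
      by (simp add: Lambda_digraph_def app_iso_def \<phi>_def with_proj_def)
  qed
  ultimately show ?thesis unfolding digraph_iso_def by blast
qed

text \<open>
  An isomorphism is injective on vertices, so the product structure of the arc set pulls back to the
  preimages of the two factors.
\<close>

lemma arcs_ends_product_digraph_iso:
  assumes "digraph_iso D H" "arcs_ends H = X' \<times> Y'" "X' \<noteq> {}" "Y' \<noteq> {}"
  shows "\<exists>X Y. X \<noteq> {} \<and> Y \<noteq> {} \<and> arcs_ends D = X \<times> Y"
proof -
  obtain \<phi> where \<phi>: "pre_digraph.digraph_isomorphism D \<phi>" and H: "H = app_iso \<phi> D"
    using assms(1) unfolding digraph_iso_def by blast
  then interpret wf_digraph D by (simp add: pre_digraph.digraph_isomorphism_def)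
  define f where "f = iso_verts \<phi>"
  have inj: "inj_on f (verts D)" using \<phi> by (simp add: f_def digraph_isomorphism_def)
  have image: "X' \<times> Y' = (\<lambda>(u, v). (f u, f v)) ` arcs_ends D"
    using arcs_ends_app_iso_eq[OF \<phi>] assms(2) by (simp add: H f_def)
  have ends: "arcs_ends D \<subseteq> verts D \<times> verts D" by (auto simp: arcs_ends_conv)
  define X Y where "X = {v \<in> verts D. f v \<in> X'}" and "Y = {v \<in> verts D. f v \<in> Y'}"
  have "arcs_ends D = X \<times> Y"
  proof
    show "arcs_ends D \<subseteq> X \<times> Y"
    proof (rule subrelI)
      fix u v assume uv: "(u, v) \<in> arcs_ends D"
      then have "(f u, f v) \<in> X' \<times> Y'" unfolding image by force
      then show "(u, v) \<in> X \<times> Y" using uv ends by (auto simp: X_def Y_def)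
    qed
    show "X \<times> Y \<subseteq> arcs_ends D"
    proof (rule subrelI)
      fix u v assume "(u, v) \<in> X \<times> Y"
      then have uv: "u \<in> verts D" "v \<in> verts D" "(f u, f v) \<in> X' \<times> Y'"
        by (simp_all add: X_def Y_def)
      from uv(3) obtain u' v' where uv': "(u', v') \<in> arcs_ends D" "f u = f u'" "f v = f v'"
        unfolding image by auto
      with ends have "u' \<in> verts D" "v' \<in> verts D" by auto
      with uv uv' have "u = u'" "v = v'" using inj by (simp_all add: inj_on_eq_iff)
      with uv' show "(u, v) \<in> arcs_ends D" by simp
    qed
  qed
  moreover have "arcs_ends D \<noteq> {}" using image assms(3,4) by auto
  ultimately show ?thesis by blast
qed

theorem corollary4p4:
  fixes D :: "('a, 'b) pre_digraph" and vs :: "'a list"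
  assumes "digraph D"
    and "Digraph_Component.connected D"
    and "distinct vs" and "set vs = verts D"
  shows "count_list (invariant_factors (adjacency_mat D vs)) 1 = 1 \<longleftrightarrow>
    (\<exists>n1 n2 n3 :: nat. digraph_iso D (Lambda_digraph n1 n2 n3) \<and>
      (n1 = 1 \<and> n2 = 1 \<and> n3 = 0 \<or>
       n1 = 1 \<and> n3 = 1 \<and> n2 = 0 \<or>
       n2 = 1 \<and> n3 = 1 \<and> n1 = 0 \<or>
       n1 \<ge> 2 \<and> n2 = 1 \<and> n3 = 0 \<or>
       n1 = 0 \<and> n2 = 1 \<and> n3 \<ge> 2 \<or>
       n1 = 1 \<and> n2 = 0 \<and> n3 \<ge> 2 \<or>
       n1 \<ge> 2 \<and> n2 = 0 \<and> n3 = 1 \<or>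
       n1 \<ge> 2 \<and> n2 = 0 \<and> n3 \<ge> 2))"
    (is "?one \<longleftrightarrow> (\<exists>n1 n2 n3. _ \<and> ?cases n1 n2 n3)")
proof -
  interpret digraph D by fact
  have "?one \<longleftrightarrow> (\<exists>X Y. X \<noteq> {} \<and> Y \<noteq> {} \<and> arcs_ends D = X \<times> Y)"
    by (rule one_unit_invariant_factor_iff_arcs_ends_product[OF nomulti_digraph assms(4)])
  also have "\<dots> \<longleftrightarrow> (\<exists>n1 n2 n3. digraph_iso D (Lambda_digraph n1 n2 n3) \<and> ?cases n1 n2 n3)"
  proof
    assume "\<exists>X Y. X \<noteq> {} \<and> Y \<noteq> {} \<and> arcs_ends D = X \<times> Y"
    then obtain X Y where XY: "X \<noteq> {}" "Y \<noteq> {}" "arcs_ends D = X \<times> Y" by blast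
    have "arcs_ends D \<subseteq> verts D \<times> verts D" unfolding arcs_ends_conv by auto
    then have "X \<subseteq> verts D" "Y \<subseteq> verts D" using XY by (simp_all add: times_subset_iff)
    then have "card X \<noteq> 0" "card Y \<noteq> 0"
      using XY(1,2) finite_verts by (simp_all add: finite_subset)
    then have "?cases (card X) 0 (card Y)" by presburger
    with digraph_iso_Lambda_digraph_of_arcs_ends_product[OF assms(1,2) XY]
    show "\<exists>n1 n2 n3. digraph_iso D (Lambda_digraph n1 n2 n3) \<and> ?cases n1 n2 n3" by blast
  next
    assume "\<exists>n1 n2 n3. digraph_iso D (Lambda_digraph n1 n2 n3) \<and> ?cases n1 n2 n3"
    then obtain n1 n2 n3 where iso: "digraph_iso D (Lambda_digraph n1 n2 n3)"
      and "?cases n1 n2 n3" by blast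
    then have "n1 \<noteq> 0 \<and> n2 = 1 \<and> n3 = 0 \<or> n1 = 0 \<and> n2 = 1 \<and> n3 \<noteq> 0 \<or> n1 \<noteq> 0 \<and> n2 = 0 \<and> n3 \<noteq> 0"
      by presburger
    then consider "n1 \<noteq> 0" "n2 = 1" "n3 = 0" | "n1 = 0" "n2 = 1" "n3 \<noteq> 0" | "n1 \<noteq> 0" "n2 = 0" "n3 \<noteq> 0"
      by blast
    then show "\<exists>X Y. X \<noteq> {} \<and> Y \<noteq> {} \<and> arcs_ends D = X \<times> Y"
    proof cases
      case 1
      then show ?thesis
        by (intro arcs_ends_product_digraph_iso[OF iso, of "VT ` {..<n1}" "VK ` {..<n2}"])
          (auto simp: Lambda_digraph_simps lessThan_empty_iff)
    next
      case 2
      then show ?thesis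
        by (intro arcs_ends_product_digraph_iso[OF iso, of "VK ` {..<n2}" "VT' ` {..<n3}"])
          (auto simp: Lambda_digraph_simps lessThan_empty_iff)
    next
      case 3
      then show ?thesis
        by (intro arcs_ends_product_digraph_iso[OF iso, of "VT ` {..<n1}" "VT' ` {..<n3}"])
          (auto simp: Lambda_digraph_simps lessThan_empty_iff)
    qed
  qed
  finally show ?thesis .
qed

end
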